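(* Let $q$ be a nonzero complex number that is not a root of $1$, let $p,d_1,d_2,d_3$ be complex numbers, and put $y=p^2$, $$k_1=y+d_1d_2+d_1d_3+d_2d_3,\qquad k_2=y(d_1+d_2+d_3)+d_1d_2d_3.$$ Define the rational functions $$Z(x)=\frac{(x-1)(x-y)}{(x^2-qy)(x^2-y)^2(qx^2-y)}\prod_{j=1}^3\bigl((x-d_j)(d_jx-y)\bigr),$$ $$V(x)=\frac{(qx-1)(k_1qx-k_2)}{(q-1)(q^2x^2-y)},\qquad V_a(x)=\frac{(qx-1)(k_2qx-yk_1)}{(q-1)(q^2x^2-y)}.$$ Suppose that $V(1)\neq0$, that $Z(q^k)\neq 0$ for all $k\geq1$, that $p\neq0$, and that $k_2q-yk_1\neq0$. Let $\alpha_1$ be a nonzero complex number, let $\sigma_0,\hat\sigma_0$ be complex numbers with $$\sigma_0^2=\frac{\alpha_1V(1)^2}{Z(q)},\qquad \hat\sigma_0^2=\frac{\alpha_1V_a(1)^2}{y\,Z(q)},$$ where the square roots are chosen so that $\hat\sigma_0=\sigma_0$ in case $\hat\sigma_0^2=\sigma_0^2$, and define $$\alpha_k=\frac{\alpha_1Z(q^k)}{Z(q)}\ (k\geq1),\qquad \sigma_k=\frac{\sigma_0V(q^k)}{V(1)}\ (k\geq0),\qquad \hat\sigma_k=\frac{\hat\sigma_0V_a(q^k)}{V_a(1)}\ (k\geq0).$$ Let $\hat L$ be the tridiagonal matrix with $\hat L_{0,0}=\hat\sigma_0$, $\hat L_{k,k}=\hat\sigma_k-\hat\sigma_{k-1}$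 for $k\geq1$, and $\hat L_{k,k+1}=1$, $\hat L_{k+1,k}=\alpha_{k+1}$ for $k\geq0$, and let $\hat A$ be the MOP determined by these recurrence coefficients, i.e. the unique monic matrix in $\mathcal G$ with $\hat L\hat A=\hat AX$. Then $\hat A$ is in the extended $q$-Hahn class $\mathcal J_{q,+}$, and $$\hat L^2D_q-(q+1)\hat LD_qM+qD_qM^2=tD_q$$ holds for some $M\in\mathcal T$ with $$t=-\frac{\alpha_1(q-1)^2d_1d_2d_3}{q^2Z(q)}.$$ Furthermore, the sequence $\hat\sigma_k$ coincides with the sequence $\sigma_k$ if and only if $p=d_j$ or $p=-d_j$ for some $j\in\{1,2,3\}$.
   Context: All matrices are infinite complex matrices whose rows and columns are indexed by the nonnegative integers. $[k]=\frac{q^k-1}{q-1}$ for $k\in\mathbb Z$. Values of rational functions are taken after cancelling common factors of numerator and denominator. $\mathcal G$ is the group of lower triangular matrices all of whose diagonal entries are nonzero; an element of $\mathcal G$ is monic if all its diagonal entries equal $1$. $\mathcal T$ is the set of tridiagonal matrices all of whose entries on the first subdiagonal and on the first superdiagonal are nonzero (the main diagonal is arbitrary). $X$ is the matrix with $X_{k,k+1}=1$ for $k\geq0$ and all other entries $0$. $D_q$ is the matrix with $(D_q)_{k+1,k}=[k+1]$ for $k\geq0$ and all other entries $0$. A monic polynomial sequence $\{p_k\}_{k\geq0}$ in $\mathbb C[x]$ (with $p_k$ monic of degree $k$) is orthogonal if there are a linear functional $\mu$ on $\mathbb C[x]$ and nonzero complex constants $\gamma_k$ with $\mu(p_kp_n)=\gamma_k\delta_{k,n}$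 for all $k,n\ge 0$. Its associated matrix (with respect to the monomials) is $A=[a_{k,j}]$, where $p_k(x)=\sum_{j=0}^k a_{k,j}x^j$. A matrix arising in this way from a monic orthogonal polynomial sequence is called a MOP (matrix of orthogonal polynomials). For a MOP $A$ there is a unique matrix $L\in\mathcal T$ with $LA=AX$ (the matrix of recurrence coefficients of $A$); it encodes the recurrence $\alpha_kp_{k-1}+\beta_kp_k+p_{k+1}=xp_k$. The extended $q$-Hahn class $\mathcal J_{q,+}$ is the set of all MOPs $A$ whose matrix $L\in\mathcal T$ of recurrence coefficients satisfies $L^2D_q-(q+1)LD_qM+qD_qM^2=tD_q$ for some $M\in\mathcal T$ and some complex number $t$.
   Formalization: In the case y=q, Z(q) is the value obtained by putting x=q with q as the variable and then cancelling (the factor (x-y)/(x^2-qy) becomes 1/q); cancelling in x alone would give 1/(2q), for which the claim fails, e.g. q=4, p=2, d=(5,7,11). *)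

theory Defs
  imports
    Complex_Main
    "HOL-Library.Groups_Big_Fun"
    "HOL-Computational_Algebra.Field_as_Ring"
    "HOL-Computational_Algebra.Polynomial_Factorial"
    "HOL-Computational_Algebra.Normalized_Fraction"
begin

section \<open>Infinite matrices\<close>

type_synonym infmat = "nat \<Rightarrow> nat \<Rightarrow> complex"

text \<open>All products formed below have a row-finite left factor, so that every entry of the
  product is a sum with only finitely many nonzero terms.\<close>

definition mmul :: "infmat \<Rightarrow> infmat \<Rightarrow> infmat" (infixl "**" 70) where
  "A ** B = (\<lambda>i j. Sum_any (\<lambda>k. A i k * B k j))"

definition GG :: "infmat set" where
  "GG = {A. (\<forall>i j. i < j \<longrightarrow> A i j = 0) \<and> (\<forall>i. A i i \<noteq> 0)}"

definition monic :: "infmat \<Rightarrow> bool" where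
  "monic A \<longleftrightarrow> (\<forall>i. A i i = 1)"

definition TT :: "infmat set" where
  "TT = {L. (\<forall>i j. i + 1 < j \<or> j + 1 < i \<longrightarrow> L i j = 0)
          \<and> (\<forall>k. L (k + 1) k \<noteq> 0) \<and> (\<forall>k. L k (k + 1) \<noteq> 0)}"

definition XX :: infmat where
  "XX = (\<lambda>i j. if j = i + 1 then 1 else 0)"

definition qbracket :: "complex \<Rightarrow> int \<Rightarrow> complex" where
  "qbracket q k = (q powi k - 1) / (q - 1)"

definition Dq :: "complex \<Rightarrow> infmat" where
  "Dq q = (\<lambda>i j. if i = j + 1 then qbracket q (int (j + 1)) else 0)"

section \<open>Matrices of orthogonal polynomials\<close>

definition monic_poly_seq :: "(nat \<Rightarrow> complex poly) \<Rightarrow> bool" where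
  "monic_poly_seq p \<longleftrightarrow> (\<forall>k. degree (p k) = k \<and> lead_coeff (p k) = 1)"

definition orthogonal_poly_seq :: "(nat \<Rightarrow> complex poly) \<Rightarrow> bool" where
  "orthogonal_poly_seq p \<longleftrightarrow>
     (\<exists>(\<mu> :: complex poly \<Rightarrow> complex) (\<gamma> :: nat \<Rightarrow> complex).
        Vector_Spaces.linear smult (*) \<mu> \<and> (\<forall>k. \<gamma> k \<noteq> 0) \<and>
        (\<forall>k n. \<mu> (p k * p n) = (if k = n then \<gamma> k else 0)))"

definition assoc_matrix :: "(nat \<Rightarrow> complex poly) \<Rightarrow> infmat" where
  "assoc_matrix p = (\<lambda>k j. coeff (p k) j)"

definition is_MOP :: "infmat \<Rightarrow> bool" where
  "is_MOP A \<longleftrightarrow> (\<exists>p. monic_poly_seq p \<and> orthogonal_poly_seq p \<and> A = assoc_matrix p)"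

definition is_recurrence_matrix :: "infmat \<Rightarrow> infmat \<Rightarrow> bool" where
  "is_recurrence_matrix A L \<longleftrightarrow> L \<in> TT \<and> L ** A = A ** XX"

definition hahn_equation :: "complex \<Rightarrow> infmat \<Rightarrow> infmat \<Rightarrow> complex \<Rightarrow> bool" where
  "hahn_equation q L M t \<longleftrightarrow>
     (\<forall>i j. (L ** L ** Dq q) i j - (q + 1) * (L ** Dq q ** M) i j + q * (Dq q ** (M ** M)) i j
            = t * Dq q i j)"

definition extended_q_Hahn :: "complex \<Rightarrow> infmat set" where
  "extended_q_Hahn q =
     {A. is_MOP A \<and>
         (\<exists>L. is_recurrence_matrix A L \<and> (\<exists>M\<in>TT. \<exists>t. hahn_equation q L M t))}"

definition MOP_of_recurrence :: "infmat \<Rightarrow> infmat" where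
  "MOP_of_recurrence L = (THE A. A \<in> GG \<and> monic A \<and> L ** A = A ** XX)"

section \<open>The rational functions and their values\<close>

text \<open>The formulas are stated over an arbitrary field, because they are used below
  over the field of rational functions.\<close>

definition k1_of :: "'a::field \<Rightarrow> 'a \<Rightarrow> 'a \<Rightarrow> 'a \<Rightarrow> 'a" where
  "k1_of y d1 d2 d3 = y + d1 * d2 + d1 * d3 + d2 * d3"

definition k2_of :: "'a::field \<Rightarrow> 'a \<Rightarrow> 'a \<Rightarrow> 'a \<Rightarrow> 'a" where
  "k2_of y d1 d2 d3 = y * (d1 + d2 + d3) + d1 * d2 * d3"

definition Z_formula :: "'a::field \<Rightarrow> 'a \<Rightarrow> 'a \<Rightarrow> 'a \<Rightarrow> 'a \<Rightarrow> 'a \<Rightarrow> 'a" where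
  "Z_formula q y d1 d2 d3 x =
     ((x - 1) * (x - y)) / ((x^2 - q * y) * (x^2 - y)^2 * (q * x^2 - y))
     * (((x - d1) * (d1 * x - y)) * ((x - d2) * (d2 * x - y)) * ((x - d3) * (d3 * x - y)))"

definition V_formula :: "'a::field \<Rightarrow> 'a \<Rightarrow> 'a \<Rightarrow> 'a \<Rightarrow> 'a \<Rightarrow> 'a \<Rightarrow> 'a" where
  "V_formula q y d1 d2 d3 x =
     ((q * x - 1) * (k1_of y d1 d2 d3 * q * x - k2_of y d1 d2 d3))
     / ((q - 1) * (q^2 * x^2 - y))"

definition Va_formula :: "'a::field \<Rightarrow> 'a \<Rightarrow> 'a \<Rightarrow> 'a \<Rightarrow> 'a \<Rightarrow> 'a \<Rightarrow> 'a" where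
  "Va_formula q y d1 d2 d3 x =
     ((q * x - 1) * (k2_of y d1 d2 d3 * q * x - y * k1_of y d1 d2 d3))
     / ((q - 1) * (q^2 * x^2 - y))"

type_synonym ratfun = "complex poly fract"

definition indet :: ratfun where
  "indet = to_fract [:0, 1:]"

definition rconst :: "complex \<Rightarrow> ratfun" where
  "rconst a = to_fract [:a:]"

text \<open>The function \<open>quot_of_fract\<close> returns coprime numerator and denominator, so this is the value
  after cancelling all common factors. At a pole the value is 0 by the convention on
  division by zero; in particular a nonzero value is never taken at a pole.\<close>

definition rf_value :: "ratfun \<Rightarrow> complex \<Rightarrow> complex" where
  "rf_value f a = poly (fst (quot_of_fract f)) a / poly (snd (quot_of_fract f)) a"

text \<open>The values of \<open>Z\<close>, \<open>V\<close>, \<open>V\<^sub>a\<close> at \<open>x = q^k\<close>. As sequences of coefficients depending on \<open>q\<close>,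
  they are regarded as rational functions of \<open>q\<close>, and common factors are
  cancelled before a number is substituted for \<open>q\<close>. For instance
  the factor \<open>(x - y) / (x^2 - q y)\<close> of \<open>Z\<close> at \<open>x = q\<close> is \<open>(q - y) / (q (q - y)) = 1 / q\<close>,
  also when \<open>q = y\<close>. (Fixing \<open>q = y\<close> first and cancelling in \<open>x\<close> alone would give
  \<open>1 / (x + q) = 1 / (2 q)\<close> instead, for which the asserted Hahn equation fails in general. When \<open>q \<noteq> y\<close>, no
  denominator vanishes at the points used under the hypotheses of the theorem and
  both conventions agree with plain substitution.)\<close>

definition Zval :: "complex \<Rightarrow> complex \<Rightarrow> complex \<Rightarrow> complex \<Rightarrow> complex \<Rightarrow> nat \<Rightarrow> complex" where
  "Zval q y d1 d2 d3 k =
     rf_value (Z_formula indet (rconst y) (rconst d1) (rconst d2) (rconst d3) (indet ^ k)) q"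

definition Vval :: "complex \<Rightarrow> complex \<Rightarrow> complex \<Rightarrow> complex \<Rightarrow> complex \<Rightarrow> nat \<Rightarrow> complex" where
  "Vval q y d1 d2 d3 k =
     rf_value (V_formula indet (rconst y) (rconst d1) (rconst d2) (rconst d3) (indet ^ k)) q"

definition Vaval :: "complex \<Rightarrow> complex \<Rightarrow> complex \<Rightarrow> complex \<Rightarrow> complex \<Rightarrow> nat \<Rightarrow> complex" where
  "Vaval q y d1 d2 d3 k =
     rf_value (Va_formula indet (rconst y) (rconst d1) (rconst d2) (rconst d3) (indet ^ k)) q"

section \<open>Recurrence coefficients\<close>

definition recurrence_matrix :: "(nat \<Rightarrow> complex) \<Rightarrow> (nat \<Rightarrow> complex) \<Rightarrow> infmat" where
  "recurrence_matrix \<alpha> \<sigma> = (\<lambda>i j.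
     if j = i then (if i = 0 then \<sigma> 0 else \<sigma> i - \<sigma> (i - 1))
     else if j = i + 1 then 1
     else if i = j + 1 then \<alpha> (j + 1)
     else 0)"

end

theory Submission
  imports Defs
begin

text \<open>
  Let \<open>[n]\<close> be the \<open>q\<close>-bracket, \<open>C = \<alpha>\<^sub>1 / Z(q)\<close>, \<open>s\<^sup>2 = C / y\<close> and
  \<open>f\<^sub>n = s (k\<^sub>2 q\<^sup>n - y k\<^sub>1) / (q\<^sup>2\<^sup>n - y)\<close>, so that the partial sum of the first \<open>n\<close> diagonal
  entries of the recurrence matrix is \<open>[n] f\<^sub>n\<close>. The matrix \<open>M\<close> is then again tridiagonal with
  superdiagonal \<open>1\<close>, the first \<open>n\<close> of its diagonal entries add up to \<open>[n] f\<^sub>n\<^sub>+\<^sub>1\<close>, and its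
  subdiagonal entries are
  \<open>M\<^sub>i\<^sub>,\<^sub>i\<^sub>-\<^sub>1 = \<alpha>\<^sub>i\<^sub>+\<^sub>1 [i] (q\<^sup>i\<^sup>+\<^sup>2 - y) / ([i+1] q (q\<^sup>i\<^sup>+\<^sup>1 - y))\<close>.
  The Hahn equation is nontrivial on five diagonals only. Four of the resulting
  scalar equations are linear in \<open>f\<close> or do not involve it. The remaining one becomes, with
  \<open>F = f\<^sub>n\<close>, \<open>H = f\<^sub>n\<^sub>+\<^sub>1\<close> and \<open>x = q\<^sup>n\<close>, a formula for \<open>(x / q) (q H - F) (H - F)\<close>, which holds since
  modulo \<open>(x\<^sup>2 - y)\<^sup>2\<close> the product of the \<open>(x - d\<^sub>j) (d\<^sub>j x - y)\<close> is congruent to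
  \<open>x\<^sup>2 (k\<^sub>1 x - k\<^sub>2) (k\<^sub>2 x - y k\<^sub>1)\<close>. The coefficient of \<open>\<alpha>\<^sub>n\<close> in that equation contains the factor
  \<open>(x\<^sup>2 - q y) / (x - y)\<close>, which makes the formula valid also for \<open>n = 1\<close> and \<open>y = q\<close>.

  No denominator vanishes, because \<open>q\<^sup>n = y\<close> with \<open>n \<ge> 2\<close> would make \<open>Z(q\<^sup>n)\<close> zero.
  Finally, the two sequences of partial sums agree iff \<open>k\<^sub>2 = l k\<^sub>1\<close> for a square root \<open>l\<close> of \<open>y\<close>,
  and \<open>l k\<^sub>1 - k\<^sub>2 = (l - d\<^sub>1) (l - d\<^sub>2) (l - d\<^sub>3)\<close>.
\<close>

section \<open>Values of rational functions\<close>

text \<open>Allowing any representation, not only the reduced one, makes the notion compatible with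
  the field operations; only division carries a side condition.\<close>

definition has_value :: "ratfun \<Rightarrow> complex \<Rightarrow> complex \<Rightarrow> bool" where
  "has_value f a v \<longleftrightarrow>
     (\<exists>N D. f = to_fract N / to_fract D \<and> poly D a \<noteq> 0 \<and> v = poly N a / poly D a)"

lemma has_valueI:
  "f = to_fract N / to_fract D \<Longrightarrow> poly D a \<noteq> 0 \<Longrightarrow> v = poly N a / poly D a \<Longrightarrow> has_value f a v"
  unfolding has_value_def by blast

lemma has_valueE:
  assumes "has_value f a v"
  obtains N D where "f = to_fract N / to_fract D" "D \<noteq> 0" "poly D a \<noteq> 0" "v = poly N a / poly D a"
  using assms unfolding has_value_def by fastforce

lemma rf_value_eq:
  assumes "has_value f a v"
  shows "rf_value f a = v"
proof -
  obtain N D where f: "f = to_fract N / to_fract D" "D \<noteq> 0" and D: "poly D a \<noteq> 0"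
    and v: "v = poly N a / poly D a"
    using assms by (rule has_valueE)
  define A where "A = fst (quot_of_fract f)"
  define B where "B = snd (quot_of_fract f)"
  have B0: "B \<noteq> 0" and cop: "coprime A B"
    by (simp_all add: A_def B_def coprime_quot_of_fract)
  have "f = to_fract A / to_fract B"
    using Fract_quot_of_fract[of f] by (simp add: A_def B_def Fract_conv_to_fract)
  then have "to_fract (N * B) = to_fract (D * A)"
    using f B0 by (simp add: field_simps)
  then have eq: "N * B = D * A"
    by (simp only: to_fract_eq_iff)
  \<comment> \<open>\<open>B\<close> divides \<open>D * A\<close> and is coprime to
    \<open>A\<close>; so the reduced denominator vanishes only where every other denominator
    does.\<close>
  have "B dvd D"
    using cop eq by (metis coprime_commute coprime_dvd_mult_left_iff dvd_triv_right)
  then have "poly B a \<noteq> 0"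
    using D by (metis dvd_trans poly_eq_0_iff_dvd)
  moreover have "poly N a * poly B a = poly D a * poly A a"
    using eq by (metis poly_mult)
  ultimately show ?thesis
    unfolding rf_value_def v using D by (simp add: A_def[symmetric] B_def[symmetric] field_simps)
qed

named_theorems value_intros

lemma has_value_indet [value_intros]: "has_value indet a a"
  by (rule has_valueI[where N = "[:0, 1:]" and D = 1]) (simp_all add: indet_def)

lemma has_value_rconst [value_intros]: "has_value (rconst c) a c"
  by (rule has_valueI[where N = "[:c:]" and D = 1]) (simp_all add: rconst_def)

lemma has_value_one [value_intros]: "has_value 1 a 1"
  by (rule has_valueI[where N = 1 and D = 1]) simp_all

lemma has_value_add [value_intros]:
  assumes "has_value f a v" "has_value g a w"
  shows "has_value (f + g) a (v + w)"
proof -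
  from assms(1) obtain N D where f: "f = to_fract N / to_fract D" "D \<noteq> 0" "poly D a \<noteq> 0"
    "v = poly N a / poly D a" by (rule has_valueE)
  from assms(2) obtain N' D' where g: "g = to_fract N' / to_fract D'" "D' \<noteq> 0" "poly D' a \<noteq> 0"
    "w = poly N' a / poly D' a" by (rule has_valueE)
  show ?thesis
    by (rule has_valueI[where N = "N * D' + N' * D" and D = "D * D'"])
      (use f(2,3) g(2,3) in \<open>simp_all add: f(1,4) g(1,4) add_frac_eq\<close>)
qed

lemma has_value_mult [value_intros]:
  assumes "has_value f a v" "has_value g a w"
  shows "has_value (f * g) a (v * w)"
proof -
  from assms(1) obtain N D where f: "f = to_fract N / to_fract D" "D \<noteq> 0" "poly D a \<noteq> 0"
    "v = poly N a / poly D a" by (rule has_valueE)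
  from assms(2) obtain N' D' where g: "g = to_fract N' / to_fract D'" "D' \<noteq> 0" "poly D' a \<noteq> 0"
    "w = poly N' a / poly D' a" by (rule has_valueE)
  show ?thesis
    by (rule has_valueI[where N = "N * N'" and D = "D * D'"]) (use f g in simp_all)
qed

lemma has_value_diff [value_intros]:
  assumes "has_value f a v" "has_value g a w"
  shows "has_value (f - g) a (v - w)"
proof -
  have "has_value (f + rconst (- 1) * g) a (v + (- 1) * w)"
    by (intro value_intros assms)
  moreover have "rconst (- 1) = - 1"
    unfolding rconst_def by (metis minus_pCons minus_zero one_pCons to_fract_1 to_fract_uminus)
  ultimately show ?thesis
    by simp
qed

lemma has_value_divide [value_intros]:
  assumes "has_value f a v" "has_value g a w" "w \<noteq> 0"
  shows "has_value (f / g) a (v / w)"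
proof -
  from assms(1) obtain N D where f: "f = to_fract N / to_fract D" "D \<noteq> 0" "poly D a \<noteq> 0"
    "v = poly N a / poly D a" by (rule has_valueE)
  from assms(2) obtain N' D' where g: "g = to_fract N' / to_fract D'" "D' \<noteq> 0" "poly D' a \<noteq> 0"
    "w = poly N' a / poly D' a" by (rule has_valueE)
  show ?thesis
    by (rule has_valueI[where N = "N * D'" and D = "D * N'"])
      (use f(2,3) g(2,3) assms(3) in \<open>simp_all add: f(1,4) g(1,4)\<close>)
qed

lemma has_value_power [value_intros]: "has_value f a v \<Longrightarrow> has_value (f ^ n) a (v ^ n)"
  by (induction n) (auto intro: value_intros)

lemma has_value_nonzero: "has_value f a v \<Longrightarrow> v \<noteq> 0 \<Longrightarrow> f \<noteq> 0"
  by (erule has_valueE) auto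

lemma Zval_eq:
  fixes q y :: complex and k :: nat
  defines "x \<equiv> q ^ k"
  assumes "x^2 - q * y \<noteq> 0" "x^2 - y \<noteq> 0" "q * x^2 - y \<noteq> 0"
  shows "Zval q y d1 d2 d3 k = Z_formula q y d1 d2 d3 x"
  unfolding Zval_def Z_formula_def x_def
  by (intro rf_value_eq value_intros) (use assms(2-) in \<open>simp_all add: x_def\<close>)

text \<open>At \<open>k = 1\<close> the factor \<open>x - y\<close> of the numerator cancels against \<open>x\<^sup>2 - q y = q (q - y)\<close>,
  so that no hypothesis \<open>q \<noteq> y\<close> is needed.\<close>

lemma Zval_1:
  assumes "q \<noteq> 0" "q^2 - y \<noteq> 0" "q * q^2 - y \<noteq> 0"
  shows "Zval q y d1 d2 d3 1 = (q - 1) / (q * (q^2 - y)^2 * (q * q^2 - y))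
    * (((q - d1) * (d1 * q - y)) * ((q - d2) * (d2 * q - y)) * ((q - d3) * (d3 * q - y)))"
proof -
  \<comment> \<open>A point different from \<open>0\<close> and \<open>y\<close>: the values there
    show that \<open>indet\<close> and \<open>indet - rconst y\<close> are nonzero, so the
    cancellation in \<open>X\<close> happens before \<open>q\<close> is substituted.\<close>
  define c where "c = (if y = 1 then 2 else 1 :: complex)"
  have "has_value indet c c" "has_value (indet - rconst y) c (c - y)"
    by (intro value_intros)+
  then have "indet - rconst y \<noteq> 0" "indet \<noteq> 0"
    by (auto dest: has_value_nonzero simp: c_def split: if_splits)
  moreover have "indet ^ 2 - indet * rconst y = indet * (indet - rconst y)"
    by (simp add: power2_eq_square right_diff_distrib)
  ultimately have X: "((indet - 1) * (indet - rconst y))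
      / ((indet^2 - indet * rconst y) * (indet^2 - rconst y)^2 * (indet * indet^2 - rconst y))
    = (indet - 1) / (indet * (indet^2 - rconst y)^2 * (indet * indet^2 - rconst y))"
    using mult_divide_mult_cancel_right[of "indet - rconst y" "indet - 1"
        "indet * (indet^2 - rconst y)^2 * (indet * indet^2 - rconst y)"]
    by (simp only: simp_thms mult.assoc mult.commute mult.left_commute)
  show ?thesis
    unfolding Zval_def Z_formula_def power_one_right X
    by (intro rf_value_eq value_intros) (use assms in simp_all)
qed

lemma Vval_eq:
  assumes "q \<noteq> 1" "q^2 * (q ^ k)^2 - y \<noteq> 0"
  shows "Vval q y d1 d2 d3 k = V_formula q y d1 d2 d3 (q ^ k)"
  unfolding Vval_def V_formula_def k1_of_def k2_of_def
  by (intro rf_value_eq value_intros) (use assms in simp_all)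

lemma Vaval_eq:
  assumes "q \<noteq> 1" "q^2 * (q ^ k)^2 - y \<noteq> 0"
  shows "Vaval q y d1 d2 d3 k = Va_formula q y d1 d2 d3 (q ^ k)"
  unfolding Vaval_def Va_formula_def k1_of_def k2_of_def
  by (intro rf_value_eq value_intros) (use assms in simp_all)

section \<open>The Hahn equation for tridiagonal matrices\<close>

text \<open>The index of \<open>\<alpha>\<close> is that of the row, so \<open>\<alpha> 0\<close>
  never occurs.\<close>

definition jacobi :: "(nat \<Rightarrow> complex) \<Rightarrow> (nat \<Rightarrow> complex) \<Rightarrow> infmat" where
  "jacobi \<beta> \<alpha> = (\<lambda>i j. if j = i then \<beta> i else if j = i + 1 then 1 else if i = j + 1 then \<alpha> i else 0)"

lemma jacobi_simps [simp]:
  "jacobi \<beta> \<alpha> i i = \<beta> i"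
  "jacobi \<beta> \<alpha> i (Suc i) = 1"
  "jacobi \<beta> \<alpha> (Suc i) i = \<alpha> (Suc i)"
  by (simp_all add: jacobi_def)

lemma jacobi_zero: "i + 1 < j \<or> j + 1 < i \<Longrightarrow> jacobi \<beta> \<alpha> i j = 0"
  by (auto simp: jacobi_def)

lemma jacobi_in_TT: "(\<And>k. k \<ge> 1 \<Longrightarrow> \<alpha> k \<noteq> 0) \<Longrightarrow> jacobi \<beta> \<alpha> \<in> TT"
  by (auto simp: TT_def jacobi_def)

lemma recurrence_matrix_eq_jacobi:
  "recurrence_matrix \<alpha> \<sigma> = jacobi (\<lambda>i. if i = 0 then \<sigma> 0 else \<sigma> i - \<sigma> (i - 1)) \<alpha>"
  by (auto simp: recurrence_matrix_def jacobi_def fun_eq_iff)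

lemma mmul_jacobi_0: "(jacobi \<beta> \<alpha> ** B) 0 j = \<beta> 0 * B 0 j + B 1 j"
proof -
  have "(jacobi \<beta> \<alpha> ** B) 0 j = (\<Sum>k\<in>{0, 1}. jacobi \<beta> \<alpha> 0 k * B k j)"
    unfolding mmul_def by (rule Sum_any.expand_superset) (auto simp: jacobi_def)
  then show ?thesis
    by (simp add: jacobi_def)
qed

lemma mmul_jacobi_Suc:
  "(jacobi \<beta> \<alpha> ** B) (Suc i) j = \<alpha> (Suc i) * B i j + \<beta> (Suc i) * B (Suc i) j + B (Suc (Suc i)) j"
proof -
  have "(jacobi \<beta> \<alpha> ** B) (Suc i) j = (\<Sum>k\<in>{i, Suc i, Suc (Suc i)}. jacobi \<beta> \<alpha> (Suc i) k * B k j)"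
    unfolding mmul_def by (rule Sum_any.expand_superset) (auto simp: jacobi_def)
  then show ?thesis
    by (simp add: jacobi_def)
qed

lemma mmul_XX: "(B ** XX) i j = (case j of 0 \<Rightarrow> 0 | Suc j' \<Rightarrow> B i j')"
proof -
  have "(B ** XX) i j = (\<Sum>k\<in>{j - 1}. B i k * XX k j)"
    unfolding mmul_def by (rule Sum_any.expand_superset) (auto simp: XX_def)
  then show ?thesis
    by (auto simp: XX_def split: nat.splits)
qed

lemma mmul_Dq_right: "(B ** Dq q) i j = B i (Suc j) * qbracket q (int (Suc j))"
proof -
  have "(B ** Dq q) i j = (\<Sum>k\<in>{Suc j}. B i k * Dq q k j)"
    unfolding mmul_def by (rule Sum_any.expand_superset) (auto simp: Dq_def)
  then show ?thesis
    by (simp add: Dq_def)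
qed

lemma mmul_Dq_left:
  "(Dq q ** B) i j = (case i of 0 \<Rightarrow> 0 | Suc i' \<Rightarrow> qbracket q (int (Suc i')) * B i' j)"
proof -
  have "(Dq q ** B) i j = (\<Sum>k\<in>{i - 1}. Dq q i k * B k j)"
    unfolding mmul_def by (rule Sum_any.expand_superset) (auto simp: Dq_def)
  then show ?thesis
    by (auto simp: Dq_def split: nat.splits)
qed

text \<open>Products of infinite matrices are not associative in general; here each row of
  \<open>jacobi \<beta> \<alpha> ** Dq q\<close> has at most three nonzero entries. For
  \<open>i < 2\<close> truncated subtraction only merges elements of the index set.\<close>

lemma mmul_jacobi_Dq_assoc: "jacobi \<beta> \<alpha> ** Dq q ** B = jacobi \<beta> \<alpha> ** (Dq q ** B)"
proof (intro ext)
  fix i j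
  have "(jacobi \<beta> \<alpha> ** Dq q ** B) i j
    = (\<Sum>k\<in>{i - 2, i - 1, i}. jacobi \<beta> \<alpha> i (Suc k) * qbracket q (int (Suc k)) * B k j)"
    unfolding mmul_def[of "jacobi \<beta> \<alpha> ** Dq q"] mmul_Dq_right
    by (rule Sum_any.expand_superset) (auto simp: jacobi_def)
  also have "\<dots> = (jacobi \<beta> \<alpha> ** (Dq q ** B)) i j"
  proof (cases i)
    case 0
    then show ?thesis
      by (simp add: mmul_jacobi_0 mmul_Dq_left)
  next
    case (Suc m)
    then show ?thesis
      by (cases m) (simp_all add: mmul_jacobi_Suc mmul_Dq_left jacobi_zero algebra_simps)
  qed
  finally show "(jacobi \<beta> \<alpha> ** Dq q ** B) i j = (jacobi \<beta> \<alpha> ** (Dq q ** B)) i j" .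
qed

text \<open>The five families are the entries with \<open>j - i\<close> from \<open>1\<close> down
  to \<open>-3\<close>; on all other diagonals both sides vanish. \<open>a 0 = 0\<close> makes
  \<open>sub1\<close> uniform in \<open>j\<close>, and in \<open>diag\<close> the truncated
  \<open>b (i - 1)\<close> at \<open>i = 0\<close> is multiplied by \<open>br 0 = 0\<close>.\<close>

lemma hahn_equation_jacobiI:
  fixes q t :: complex and a b \<alpha> \<beta> :: "nat \<Rightarrow> complex"
  defines "br \<equiv> \<lambda>n. qbracket q (int n)"
  assumes a0: "a 0 = 0"
    and above: "\<And>i. br (i + 2) - (q + 1) * br (i + 1) + q * br i = 0"
    and diag: "\<And>i. br (i + 1) * (\<beta> i + \<beta> (i + 1)) - (q + 1) * (br i * \<beta> i + br (i + 1) * b i)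
      + q * br i * (b (i - 1) + b i) = 0"
    and sub1: "\<And>j. br (j + 1) * (\<alpha> (j + 1) + \<beta> (j + 1) ^ 2 + \<alpha> (j + 2))
      - (q + 1) * (br j * \<alpha> (j + 1) + br (j + 1) * \<beta> (j + 1) * b j + br (j + 2) * a (j + 1))
      + q * br (j + 1) * (a j + b j ^ 2 + a (j + 1)) = t * br (j + 1)"
    and sub2: "\<And>j. br (j + 1) * \<alpha> (j + 2) * (\<beta> (j + 1) + \<beta> (j + 2))
      - (q + 1) * (br (j + 1) * \<alpha> (j + 2) * b j + br (j + 2) * \<beta> (j + 2) * a (j + 1))
      + q * br (j + 2) * a (j + 1) * (b j + b (j + 1)) = 0"
    and sub3: "\<And>j. br (j + 1) * \<alpha> (j + 2) * \<alpha> (j + 3) - (q + 1) * br (j + 2) * \<alpha> (j + 3) * a (j + 1)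
      + q * br (j + 3) * a (j + 1) * a (j + 2) = 0"
  shows "hahn_equation q (jacobi \<beta> \<alpha>) (jacobi b a) t"
proof -
  have br: "qbracket q (int n) = br n" for n
    by (simp add: br_def)
  let ?E = "\<lambda>i j. (jacobi \<beta> \<alpha> ** jacobi \<beta> \<alpha> ** Dq q) i j
    - (q + 1) * (jacobi \<beta> \<alpha> ** Dq q ** jacobi b a) i j
    + q * (Dq q ** (jacobi b a ** jacobi b a)) i j"
  have Dq_entry: "Dq q i j = (if i = Suc j then br (Suc j) else 0)" for i j
    by (simp add: Dq_def br_def)
  note mm = mmul_jacobi_Dq_assoc mmul_Dq_right[of _ q, unfolded br]
    mmul_Dq_left[of q, unfolded br] mmul_jacobi_0 mmul_jacobi_Suc jacobi_zero Dq_entry br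
  have br0: "br 0 = 0"
    by (simp add: br_def qbracket_def)
  have "?E i j = t * Dq q i j" for i j
  proof -
    consider "j \<ge> i + 2" | "j = Suc i" | "j = i" | "i = Suc j" | "i = Suc (Suc j)"
      | "i = Suc (Suc (Suc j))" | "i \<ge> j + 4"
      by linarith
    then show ?thesis
    proof cases
      case 1
      then obtain m where "j = Suc (Suc (i + m))"
        by (auto simp: le_iff_add)
      then show ?thesis
        by (cases i; cases "i - 1") (simp_all add: mm)
    next
      case 2
      then show ?thesis
        using above[of i] by (cases i; cases "i - 1") (simp_all add: mm br0 algebra_simps)
    next
      case 3
      then show ?thesis
        using diag[of i] by (cases i; cases "i - 1") (simp_all add: mm br0 algebra_simps)
    next
      case 4
      then show ?thesis
        using sub1[of j] a0 by (cases j; cases "j - 1") (simp_all add: mm br0 algebra_simps power2_eq_square)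
    next
      case 5
      then show ?thesis
        using sub2[of j] by (simp add: mm algebra_simps)
    next
      case 6
      then show ?thesis
        using sub3[of j] by (simp add: mm algebra_simps numeral_3_eq_3)
    next
      case 7
      then obtain m where "i = Suc (Suc (Suc (Suc (j + m))))"
        by (auto simp: le_iff_add)
      then show ?thesis
        by (simp add: mm)
    qed
  qed
  then show ?thesis
    unfolding hahn_equation_def by blast
qed

section \<open>Favard's theorem\<close>

fun jacobi_poly :: "(nat \<Rightarrow> complex) \<Rightarrow> (nat \<Rightarrow> complex) \<Rightarrow> nat \<Rightarrow> complex poly" where
  "jacobi_poly \<beta> \<alpha> 0 = 1"
| "jacobi_poly \<beta> \<alpha> (Suc 0) = [:- \<beta> 0, 1:]"
| "jacobi_poly \<beta> \<alpha> (Suc (Suc n)) =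
     [:- \<beta> (Suc n), 1:] * jacobi_poly \<beta> \<alpha> (Suc n) - smult (\<alpha> (Suc n)) (jacobi_poly \<beta> \<alpha> n)"

lemma jacobi_poly_monic:
  "degree (jacobi_poly \<beta> \<alpha> n) = n \<and> lead_coeff (jacobi_poly \<beta> \<alpha> n) = 1"
proof (induction \<beta> \<alpha> n rule: jacobi_poly.induct)
  case (3 \<beta> \<alpha> n)
  let ?p = "[:- \<beta> (Suc n), 1:] * jacobi_poly \<beta> \<alpha> (Suc n)"
  let ?r = "smult (\<alpha> (Suc n)) (jacobi_poly \<beta> \<alpha> n)"
  have ne: "jacobi_poly \<beta> \<alpha> (Suc n) \<noteq> 0"
    using 3 by auto
  have deg: "degree ?p = Suc (Suc n)"
    using 3 ne by (subst degree_mult_eq) auto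
  have lc: "lead_coeff ?p = 1"
    by (simp only: lead_coeff_mult) (use 3 in auto)
  have "degree ?r < degree ?p"
    using 3 deg by (simp del: mult_pCons_left)
  then have "degree (?p - ?r) = degree ?p" "lead_coeff (?p - ?r) = lead_coeff ?p"
    using degree_add_eq_left[of "- ?r" ?p] lead_coeff_add_le[of ?p "- ?r"]
      coeff_eq_0[of ?r "degree ?p"] by simp_all
  then show ?case
    using deg lc by simp
qed auto

lemma monic_poly_seq_jacobi_poly: "monic_poly_seq (jacobi_poly \<beta> \<alpha>)"
  using jacobi_poly_monic unfolding monic_poly_seq_def by blast

lemma assoc_matrix_monic:
  assumes "monic_poly_seq p"
  shows "assoc_matrix p \<in> GG" "monic (assoc_matrix p)"
  using assms unfolding monic_poly_seq_def GG_def monic_def assoc_matrix_def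
  by (auto intro: coeff_eq_0) (metis one_neq_zero)+

lemma jacobi_recurrence:
  "jacobi \<beta> \<alpha> ** assoc_matrix (jacobi_poly \<beta> \<alpha>) = assoc_matrix (jacobi_poly \<beta> \<alpha>) ** XX"
proof (intro ext)
  fix i j
  show "(jacobi \<beta> \<alpha> ** assoc_matrix (jacobi_poly \<beta> \<alpha>)) i j
    = (assoc_matrix (jacobi_poly \<beta> \<alpha>) ** XX) i j"
    by (cases i) (auto simp: mmul_jacobi_0 mmul_jacobi_Suc mmul_XX assoc_matrix_def coeff_pCons
        split: nat.splits)
qed

text \<open>The equation yields row \<open>i + 2\<close> from rows \<open>i\<close> and
  \<open>i + 1\<close>, and row 1 from row 0, which is a unit vector by triangularity and
  monicity.\<close>

lemma recurrence_unique:
  assumes "A \<in> GG" "monic A" "jacobi \<beta> \<alpha> ** A = A ** XX"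
    and "B \<in> GG" "monic B" "jacobi \<beta> \<alpha> ** B = B ** XX"
  shows "A = B"
proof -
  have rec0: "C (Suc 0) j = (case j of 0 \<Rightarrow> 0 | Suc j' \<Rightarrow> C 0 j') - \<beta> 0 * C 0 j"
    and rec: "C (Suc (Suc i)) j = (case j of 0 \<Rightarrow> 0 | Suc j' \<Rightarrow> C (Suc i) j')
      - \<alpha> (Suc i) * C i j - \<beta> (Suc i) * C (Suc i) j"
    if "jacobi \<beta> \<alpha> ** C = C ** XX" for C i j
    using fun_cong[OF fun_cong[OF that, of 0], of j] fun_cong[OF fun_cong[OF that, of "Suc i"], of j]
    unfolding mmul_jacobi_0 mmul_jacobi_Suc mmul_XX by (simp_all add: algebra_simps)
  have "A i = B i \<and> A (Suc i) = B (Suc i)" for i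
  proof (induction i)
    case 0
    have "C 0 = (\<lambda>j. if j = 0 then 1 else 0)" if "C \<in> GG" "monic C" for C
      using that by (auto simp: GG_def monic_def)
    then have "A 0 = B 0"
      using assms(1,2,4,5) by metis
    then show ?case
      using rec0[OF assms(3)] rec0[OF assms(6)] by (auto simp: fun_eq_iff split: nat.split)
  next
    case (Suc i)
    then show ?case
      using rec[OF assms(3)] rec[OF assms(6)] by (auto simp: fun_eq_iff split: nat.split)
  qed
  then show ?thesis
    by blast
qed

lemma MOP_of_recurrence_jacobi:
  "MOP_of_recurrence (jacobi \<beta> \<alpha>) = assoc_matrix (jacobi_poly \<beta> \<alpha>)"
  unfolding MOP_of_recurrence_def
  using assoc_matrix_monic[OF monic_poly_seq_jacobi_poly] jacobi_recurrence recurrence_unique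
  by (intro the_equality) blast+

definition jacobi_shift :: "(nat \<Rightarrow> complex) \<Rightarrow> (nat \<Rightarrow> complex) \<Rightarrow> (nat \<Rightarrow> complex) \<Rightarrow> nat \<Rightarrow> complex"
  where "jacobi_shift \<beta> \<alpha> v =
    (\<lambda>n. (if n = 0 then 0 else v (n - 1)) + \<beta> n * v n + \<alpha> (Suc n) * v (Suc n))"

text \<open>The coordinates of a polynomial in the basis \<open>jacobi_poly \<beta> \<alpha>\<close>: multiplication by the
  variable acts on coordinates as the transposed Jacobi matrix.\<close>

definition jacobi_coords :: "(nat \<Rightarrow> complex) \<Rightarrow> (nat \<Rightarrow> complex) \<Rightarrow> complex poly \<Rightarrow> nat \<Rightarrow> complex"
  where "jacobi_coords \<beta> \<alpha> f =
    fold_coeffs (\<lambda>c v n. (if n = 0 then c else 0) + jacobi_shift \<beta> \<alpha> v n) f (\<lambda>_. 0)"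

lemma jacobi_coords_0 [simp]: "jacobi_coords \<beta> \<alpha> 0 = (\<lambda>_. 0)"
  by (simp add: jacobi_coords_def)

lemma jacobi_coords_pCons: "jacobi_coords \<beta> \<alpha> (pCons c f) =
    (\<lambda>n. (if n = 0 then c else 0) + jacobi_shift \<beta> \<alpha> (jacobi_coords \<beta> \<alpha> f) n)"
  \<comment> \<open>\<open>pCons 0 0\<close> is the zero polynomial, over which the fold does
    nothing; this agrees with the formula because the shift of the zero vector is zero.\<close>
  by (cases "c = 0 \<and> f = 0")
    (auto simp: jacobi_coords_def jacobi_shift_def fun_eq_iff)

lemma jacobi_coords_add:
  "jacobi_coords \<beta> \<alpha> (f + g) = (\<lambda>n. jacobi_coords \<beta> \<alpha> f n + jacobi_coords \<beta> \<alpha> g n)"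
  by (induction f g rule: poly_induct2)
    (auto simp: jacobi_coords_pCons jacobi_shift_def algebra_simps fun_eq_iff)

lemma jacobi_coords_smult: "jacobi_coords \<beta> \<alpha> (smult c f) = (\<lambda>n. c * jacobi_coords \<beta> \<alpha> f n)"
  by (induction f) (auto simp: jacobi_coords_pCons jacobi_shift_def algebra_simps fun_eq_iff)

lemma jacobi_coords_diff:
  "jacobi_coords \<beta> \<alpha> (f - g) = (\<lambda>n. jacobi_coords \<beta> \<alpha> f n - jacobi_coords \<beta> \<alpha> g n)"
  using jacobi_coords_add[of \<beta> \<alpha> f "smult (- 1) g"] jacobi_coords_smult[of \<beta> \<alpha> "- 1" g]
  by simp

lemma jacobi_coords_mult_linear: "jacobi_coords \<beta> \<alpha> ([:- c, 1:] * f) =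
    (\<lambda>n. jacobi_shift \<beta> \<alpha> (jacobi_coords \<beta> \<alpha> f) n - c * jacobi_coords \<beta> \<alpha> f n)"
  by (simp add: jacobi_coords_add jacobi_coords_smult jacobi_coords_pCons jacobi_coords_diff)

text \<open>The shift sends the unit vector with index \<open>n + 1\<close> to the three terms of
  the recurrence; subtracting two of them leaves the unit vector with index
  \<open>n + 2\<close>.\<close>

lemma jacobi_coords_jacobi_poly:
  "jacobi_coords \<beta> \<alpha> (jacobi_poly \<beta> \<alpha> n) = (\<lambda>k. if k = n then 1 else 0)"
proof (induction n rule: induct_nat_012)
  case 0
  show ?case
    unfolding jacobi_poly.simps one_pCons
    by (auto simp: jacobi_coords_pCons jacobi_shift_def fun_eq_iff)
next
  case 1
  show ?case
    by (auto simp: jacobi_coords_pCons jacobi_shift_def fun_eq_iff)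
next
  case (ge2 n)
  then show ?case
    by (auto simp: jacobi_coords_mult_linear jacobi_coords_diff jacobi_coords_smult
        jacobi_shift_def fun_eq_iff simp del: mult_pCons_left)
qed

text \<open>The orthogonality functional is the coordinate with index \<open>0\<close>. The induction works because the
  weights \<open>\<alpha>\<^sub>1 \<dots> \<alpha>\<^sub>k\<close> symmetrise the transposed Jacobi matrix.\<close>

lemma jacobi_coords_mult_jacobi_poly:
  "jacobi_coords \<beta> \<alpha> (jacobi_poly \<beta> \<alpha> k * g) 0 = (\<Prod>i=1..k. \<alpha> i) * jacobi_coords \<beta> \<alpha> g k"
proof (induction k arbitrary: g rule: induct_nat_012)
  case 1
  show ?case
    unfolding jacobi_poly.simps jacobi_coords_mult_linear by (simp add: jacobi_shift_def)
next
  case (ge2 k)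
  \<comment> \<open>The linear factor is moved onto \<open>g\<close>. In the coordinate with index
    \<open>k + 1\<close> of the new product, the part from index \<open>k\<close> cancels against
    the last term, and the part from index \<open>k + 2\<close> brings the next factor of the
    weight.\<close>
  have "jacobi_poly \<beta> \<alpha> (Suc (Suc k)) * g = jacobi_poly \<beta> \<alpha> (Suc k) * ([:- \<beta> (Suc k), 1:] * g)
      - smult (\<alpha> (Suc k)) (jacobi_poly \<beta> \<alpha> k * g)"
    by (simp only: jacobi_poly.simps left_diff_distrib mult_smult_left mult.assoc mult.left_commute)
  then show ?case
    by (simp only: jacobi_coords_diff jacobi_coords_smult ge2 jacobi_coords_mult_linear)
      (simp add: jacobi_shift_def algebra_simps)
qed simp

lemma jacobi_poly_orthogonal:
  assumes "\<And>k. k \<ge> 1 \<Longrightarrow> \<alpha> k \<noteq> 0"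
  shows "orthogonal_poly_seq (jacobi_poly \<beta> \<alpha>)"
  unfolding orthogonal_poly_seq_def
proof (intro exI conjI allI)
  show "Vector_Spaces.linear smult (*) (\<lambda>f. jacobi_coords \<beta> \<alpha> f 0)"
    by unfold_locales (simp_all add: jacobi_coords_add jacobi_coords_smult smult_add_left smult_add_right
        algebra_simps)
  show "(\<Prod>i=1..k. \<alpha> i) \<noteq> 0" for k
    using assms by simp
  show "jacobi_coords \<beta> \<alpha> (jacobi_poly \<beta> \<alpha> k * jacobi_poly \<beta> \<alpha> n) 0
      = (if k = n then \<Prod>i=1..k. \<alpha> i else 0)" for k n
    unfolding jacobi_coords_mult_jacobi_poly jacobi_coords_jacobi_poly by simp
qed

lemma is_MOP_of_recurrence:
  assumes "\<And>k. k \<ge> 1 \<Longrightarrow> \<alpha> k \<noteq> 0"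
  shows "is_MOP (MOP_of_recurrence (jacobi \<beta> \<alpha>))"
    and "is_recurrence_matrix (MOP_of_recurrence (jacobi \<beta> \<alpha>)) (jacobi \<beta> \<alpha>)"
  using monic_poly_seq_jacobi_poly jacobi_poly_orthogonal[of \<alpha> \<beta>] jacobi_in_TT[of \<alpha> \<beta>]
    jacobi_recurrence assms
  unfolding MOP_of_recurrence_jacobi is_MOP_def is_recurrence_matrix_def by blast+

section \<open>The scalar identities\<close>

text \<open>The terms without \<open>F\<close> come from dividing the product by
  \<open>(x^2 - y)^2\<close>; what is left over is itself a multiple of \<open>(x^2 - y)^2\<close>
  once it is written in terms of \<open>F\<close>.\<close>

lemma cubic_quotient_decomposition:
  fixes x y d1 d2 d3 F :: "'a::field"
  defines "e1 \<equiv> d1 + d2 + d3" and "e2 \<equiv> d1 * d2 + d1 * d3 + d2 * d3" and "e3 \<equiv> d1 * d2 * d3"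
  defines "k1 \<equiv> k1_of y d1 d2 d3" and "k2 \<equiv> k2_of y d1 d2 d3"
  assumes "x^2 - y \<noteq> 0" "y \<noteq> 0"
    and F: "F * (x^2 - y) = k2 * x - y * k1"
  shows "((x - d1) * (d1 * x - y)) * ((x - d2) * (d2 * x - y)) * ((x - d3) * (d3 * x - y))
      / (x^2 - y)^2
    = e3 * (x^2 + y) - (e1 * e3 + y * e2) * x + x^2 * F * (k2 - x * F) / y"
proof -
  define P where "P = ((x - d1) * (d1 * x - y)) * ((x - d2) * (d2 * x - y)) * ((x - d3) * (d3 * x - y))"
  have P: "P = (x^2 - y)^2 * (e3 * (x^2 + y) - (e1 * e3 + y * e2) * x)
    + x^2 * (k1 * x - k2) * (k2 * x - y * k1)"
    unfolding P_def e1_def e2_def e3_def k1_def k2_def k1_of_def k2_of_def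
    by (simp add: power2_eq_square algebra_simps)
  have "y * (k1 * x - k2) = (x^2 - y) * (k2 - x * F)"
    using F by (simp add: power2_eq_square) algebra
  then have "y * ((k1 * x - k2) * (k2 * x - y * k1)) = (x^2 - y)^2 * (F * (k2 - x * F))"
    unfolding F[symmetric] by (simp add: power2_eq_square)
  then have "(k1 * x - k2) * (k2 * x - y * k1) = (x^2 - y)^2 * (F * (k2 - x * F) / y)"
    using assms by (simp add: field_simps)
  then have "P = (x^2 - y)^2
    * (e3 * (x^2 + y) - (e1 * e3 + y * e2) * x + x^2 * F * (k2 - x * F) / y)"
    unfolding P mult.assoc by (simp only:) (simp add: algebra_simps)
  then show ?thesis
    unfolding P_def[symmetric] using assms by simp
qed

text \<open>\<open>F\<close> and \<open>H\<close> are the values of one function at \<open>x\<close>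
  and \<open>q * x\<close>. The term with \<open>d1 * d2 * d3\<close> is the source of the constant
  \<open>t\<close>.\<close>

lemma quadratic_relation:
  fixes q x y d1 d2 d3 F H :: "'a::field"
  defines "P \<equiv> \<lambda>x. ((x - d1) * (d1 * x - y)) * ((x - d2) * (d2 * x - y)) * ((x - d3) * (d3 * x - y))"
  defines "k1 \<equiv> k1_of y d1 d2 d3" and "k2 \<equiv> k2_of y d1 d2 d3"
  assumes nz: "x^2 - y \<noteq> 0" "(q * x)^2 - y \<noteq> 0" "q * x^2 - y \<noteq> 0" "y \<noteq> 0" "q \<noteq> 0"
    and F: "F * (x^2 - y) = k2 * x - y * k1"
    and H: "H * ((q * x)^2 - y) = k2 * (q * x) - y * k1"
  shows "x / y * (q * H - F) * (H - F) = - ((q - 1)^2 * (d1 * d2 * d3)) / q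
    + (q - 1) / (q * x^2 - y) * (P (q * x) / ((q * x)^2 - y)^2 / q - P x / (x^2 - y)^2)"
proof -
  define e1 where "e1 = d1 + d2 + d3"
  define e2 where "e2 = d1 * d2 + d1 * d3 + d2 * d3"
  define e3 where "e3 = d1 * d2 * d3"
  define c where "c = e1 * e3 + y * e2"
  have PF: "P x / (x^2 - y)^2 = e3 * (x^2 + y) - c * x + x^2 * F * (k2 - x * F) / y"
    using cubic_quotient_decomposition[OF nz(1,4) F[unfolded k1_def k2_def]]
    by (simp add: P_def c_def e1_def e2_def e3_def k2_def)
  have PH: "P (q * x) / ((q * x)^2 - y)^2
      = e3 * ((q * x)^2 + y) - c * (q * x) + (q * x)^2 * H * (k2 - (q * x) * H) / y"
    using cubic_quotient_decomposition[OF nz(2,4) H[unfolded k1_def k2_def]]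
    by (simp add: P_def c_def e1_def e2_def e3_def k2_def)
  have lin: "(H - F) * (q * x^2 - y) = (q - 1) * x * (k2 - x * (q * H + F))"
    using F H by (simp add: power2_eq_square) algebra
  \<comment> \<open>The weight \<open>1 / q\<close> removes the term linear in \<open>x\<close>,
    since \<open>c * (q * x) / q = c * x\<close>.\<close>
  have "P (q * x) / ((q * x)^2 - y)^2 / q - P x / (x^2 - y)^2
    = (q - 1) * (q * x^2 - y) * e3 / q + x^2 / y * ((q * H - F) * (k2 - x * (q * H + F)))"
    unfolding PF PH using nz(4,5)
    by (simp add: field_simps power2_eq_square)
  then have "(q - 1) / (q * x^2 - y) * (P (q * x) / ((q * x)^2 - y)^2 / q - P x / (x^2 - y)^2)
    = (q - 1)^2 * e3 / q
      + x / y * (q * H - F) * ((q - 1) * x * (k2 - x * (q * H + F)) / (q * x^2 - y))"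
    using nz(3) by (simp only:) (simp add: distrib_left power2_eq_square mult_ac)
  also have "(q - 1) * x * (k2 - x * (q * H + F)) / (q * x^2 - y) = H - F"
    unfolding lin[symmetric] using nz(3) by simp
  finally show ?thesis
    by (simp add: e3_def)
qed

text \<open>\<open>E\<close>, \<open>F\<close>, \<open>H\<close> are the values of one function at
  \<open>x / q\<close>, \<open>x\<close>, \<open>q * x\<close>. With denominators cleared, the left
  side is a combination of their three defining equations in which the right sides cancel.\<close>

lemma linear_relation:
  fixes q x y k1 k2 E F H :: "'a::field"
  assumes nz: "q \<noteq> 0" "x - y \<noteq> 0"
    and E: "E * (x^2 - q^2 * y) = q * (k2 * x - q * y * k1)"
    and F: "F * (x^2 - y) = k2 * x - y * k1"
    and H: "H * ((q * x)^2 - y) = k2 * (q * x) - y * k1"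
  shows "(q * x - 1) * H - (x - q) / q * E - (q + 1) * ((x - q) / q * F - (x - q^2) / q^2 * E)
    + (q * x - y) / (q * (x - y)) * (q * ((x - 1) * H - (x - q^2) / q^2 * E)
        - (q + 1) * ((q * x - 1) * H - (x - 1) * F)) = 0" (is "?lhs = 0")
proof -
  have "?lhs * (q^3 * (x - y)) =
    (1 - q) * (q^2 * (H * ((q * x)^2 - y)) - q^2 * (q + 1) * (F * (x^2 - y)) + q * (E * (x^2 - q^2 * y)))"
    using nz by (simp add: divide_simps) (simp add: power2_eq_square power3_eq_cube algebra_simps)
  also have "\<dots> = 0"
    unfolding E F H by (simp add: power2_eq_square algebra_simps)
  finally show ?thesis
    using nz by simp
qed

text \<open>Both \<open>\<alpha>\<close> and \<open>a\<close> are multiples of \<open>w\<close>, and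
  their joint coefficient contains \<open>x^2 - q * y\<close>, which cancels that factor of the
  denominator of \<open>\<alpha>\<close>.\<close>

lemma lower_coefficient:
  fixes q x y K \<alpha> a :: "'a::field"
  assumes "q \<noteq> 0" "x - 1 \<noteq> 0" "x - y \<noteq> 0" "x^2 - q * y \<noteq> 0"
    and \<alpha>: "\<alpha> = (x - 1) * (x - y) / (x^2 - q * y) * K"
    and a: "a = \<alpha> * ((x / q - 1) / (x - 1)) * ((q * x - y) / (q * (x - y)))"
  shows "((x - 1) - (q + 1) * (x / q - 1)) * \<alpha> + q * (x - 1) * a = (x - 1) * ((q - 1) * K / q)"
proof -
  define w where "w = \<alpha> / (x - y)"
  have "q * (x - 1) * a = w * ((x / q - 1) * (q * x - y))"
    using assms(1-3) by (simp add: a w_def)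
  moreover have "\<alpha> = w * (x - y)"
    using assms(3) by (simp add: w_def)
  ultimately have "((x - 1) - (q + 1) * (x / q - 1)) * \<alpha> + q * (x - 1) * a
      = w * (((x - 1) - (q + 1) * (x / q - 1)) * (x - y) + (x / q - 1) * (q * x - y))"
    by (simp only: distrib_left mult.left_commute)
  also have "((x - 1) - (q + 1) * (x / q - 1)) * (x - y) + (x / q - 1) * (q * x - y)
      = (q - 1) * (x^2 - q * y) / q"
    using assms(1) by (simp add: field_simps power2_eq_square)
  also have "w = (x - 1) * K / (x^2 - q * y)"
    using assms(3) by (simp add: w_def \<alpha>)
  finally show ?thesis
    using assms(4) by simp
qed

text \<open>Counterpart of \<open>lower_coefficient\<close> for the preceding scalar equation, where
  the same \<open>\<alpha>\<close> and \<open>a\<close> occur: now the other denominator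
  \<open>q * x^2 - y\<close> cancels.\<close>

lemma upper_coefficient:
  fixes q x y K \<alpha> a :: "'a::field"
  assumes "q \<noteq> 0" "x - 1 \<noteq> 0" "x - y \<noteq> 0" "q * x^2 - y \<noteq> 0"
    and \<alpha>: "\<alpha> = (x - 1) * (x - y) / (q * x^2 - y) * K"
    and a: "a = \<alpha> * ((x / q - 1) / (x - 1)) * ((q * x - y) / (q * (x - y)))"
  shows "(x / q - 1) * \<alpha> + (q * (x / q - 1) - (q + 1) * (x - 1)) * a
    = - ((x / q - 1) * ((q - 1) * K / q))"
proof -
  define w where "w = (x / q - 1) * K / (q * (q * x^2 - y))"
  have c: "q * (x / q - 1) - (q + 1) * (x - 1) = - (q * x - 1)"
    using assms(1) by (simp add: field_simps)
  have a': "a = w * (q * x - y)"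
    using assms(2,3) by (simp add: a \<alpha> w_def mult_ac)
  have \<alpha>': "(x / q - 1) * \<alpha> = w * ((x - 1) * q * (x - y))"
    using assms(1) by (simp add: \<alpha> w_def)
  have "(x / q - 1) * \<alpha> + (q * (x / q - 1) - (q + 1) * (x - 1)) * a
      = - (w * ((q - 1) * (q * x^2 - y)))"
    unfolding a' \<alpha>' c by (simp add: algebra_simps power2_eq_square)
  also have "w * ((q - 1) * (q * x^2 - y)) = (x / q - 1) * ((q - 1) * K / q)"
    using assms(4) by (simp add: w_def)
  finally show ?thesis .
qed

lemma qbracket_nat: "qbracket q (int n) = (q ^ n - 1) / (q - 1)"
  by (simp add: qbracket_def)

text \<open>Up to a factor \<open>q\<close>, each expression is \<open>q^m - y\<close> with
  \<open>m\<close> at least 2, namely \<open>m = n\<close>, \<open>2n\<close>,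
  \<open>2n + 1\<close>, \<open>2n - 1\<close>.\<close>

lemma nonvanishing_shifts:
  fixes q y :: "'a::field"
  assumes q: "q \<noteq> 0" and y: "\<forall>n\<ge>2. q ^ n \<noteq> y"
  shows "n \<ge> 2 \<Longrightarrow> q ^ n - y \<noteq> 0"
    and "n \<ge> 1 \<Longrightarrow> (q ^ n)^2 - y \<noteq> 0"
    and "n \<ge> 1 \<Longrightarrow> q * (q ^ n)^2 - y \<noteq> 0"
    and "n \<ge> 2 \<Longrightarrow> (q ^ n)^2 - q * y \<noteq> 0"
proof -
  show "q ^ n - y \<noteq> 0" if "n \<ge> 2"
    using y that by simp
  show "(q ^ n)^2 - y \<noteq> 0" if "n \<ge> 1"
    using y[rule_format, of "n * 2"] that by (simp add: power_mult)
  show up: "q * (q ^ n)^2 - y \<noteq> 0" if "n \<ge> 1" for n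
    using y[rule_format, of "Suc (n * 2)"] that by (simp add: power_mult)
  show "(q ^ n)^2 - q * y \<noteq> 0" if "n \<ge> 2"
  proof -
    obtain m where n: "n = Suc m"
      using \<open>n \<ge> 2\<close> by (cases n) auto
    then have "m \<ge> 1"
      using \<open>n \<ge> 2\<close> by simp
    with n show ?thesis
      using q up[of m] by (simp add: power2_eq_square mult_ac)
  qed
qed

text \<open>\<open>\<alpha> 1\<close> has a hypothesis of its own, with
  \<open>(x - y) / (x^2 - q * y)\<close> already cancelled to \<open>1 / q\<close>, so that
  \<open>y = q\<close> is covered; there \<open>Z_formula\<close> would divide by zero.\<close>

lemma hahn_equation_explicit:
  fixes q y d1 d2 d3 C s :: complex and \<alpha> :: "nat \<Rightarrow> complex"
  defines "P \<equiv> \<lambda>x. ((x - d1) * (d1 * x - y)) * ((x - d2) * (d2 * x - y)) * ((x - d3) * (d3 * x - y))"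
    and "k1 \<equiv> k1_of y d1 d2 d3" and "k2 \<equiv> k2_of y d1 d2 d3"
    and "br \<equiv> \<lambda>n. qbracket q (int n)"
  defines "f \<equiv> \<lambda>n. s * ((k2 * q ^ n - y * k1) / ((q ^ n)^2 - y))"
  defines "\<beta> \<equiv> \<lambda>i. br (i + 1) * f (i + 1) - br i * f i"
    and "b \<equiv> \<lambda>i. br (i + 1) * f (i + 2) - br i * f (i + 1)"
    and "a \<equiv> \<lambda>i. \<alpha> (i + 1) * (br i / br (i + 1)) * ((q ^ (i + 2) - y) / (q * (q ^ (i + 1) - y)))"
  assumes q: "q \<noteq> 0" "\<forall>n\<ge>1. q ^ n \<noteq> 1"
    and y: "y \<noteq> 0" "\<forall>n\<ge>2. q ^ n \<noteq> y"
    and s: "s^2 = C / y"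
    and \<alpha>1: "\<alpha> 1 = C * ((q - 1) / (q * (q^2 - y)^2 * (q * q^2 - y)) * P q)"
    and \<alpha>: "\<And>n. n \<ge> 2 \<Longrightarrow> \<alpha> n = C * Z_formula q y d1 d2 d3 (q ^ n)"
  shows "hahn_equation q (jacobi \<beta> \<alpha>) (jacobi b a) (- (C * (q - 1)^2 * (d1 * d2 * d3)) / q^2)"
proof -
  let ?t = "- (C * (q - 1)^2 * (d1 * d2 * d3)) / q^2"
  have q1: "q - 1 \<noteq> 0"
    using q(2)[rule_format, of 1] by simp
  have br: "br n = (q ^ n - 1) / (q - 1)" for n
    by (simp add: br_def qbracket_nat)
  have qb: "qbracket q (int n) = br n" for n
    by (simp add: br_def)
  have br0: "br 0 = 0" and br1: "br (Suc 0) = 1"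
    using q1 by (simp_all add: br)
  have br_Suc: "br (Suc n) = q * br n + 1" for n
    using q1 by (simp add: br field_simps)
  have br_nz: "br (Suc n) \<noteq> 0" for n
    using q1 q(2)[rule_format, of "Suc n"] by (simp add: br)
  have br_power: "br (Suc n) - br n = q ^ n" for n
  proof -
    have "br (Suc n) - br n = (q - 1) * q ^ n / (q - 1)"
      by (simp add: br left_diff_distrib flip: diff_divide_distrib)
    then show ?thesis
      using q1 by simp
  qed
  note ne = nonvanishing_shifts(1)[OF q(1) y(2)] and sq = nonvanishing_shifts(2)[OF q(1) y(2)]
    and sq_up = nonvanishing_shifts(3)[OF q(1) y(2)] and sq_down = nonvanishing_shifts(4)[OF q(1) y(2)]

  \<comment> \<open>Contributions of the subdiagonal entries\<close>
  define G where "G n = P (q ^ n) / ((q ^ n)^2 - y)^2" for n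
  have \<alpha>_G: "\<alpha> n = (q ^ n - 1) * (q ^ n - y) / ((q ^ n)^2 - q * y) * (C * G n / (q * (q ^ n)^2 - y))"
    if "n \<ge> 2" for n
    unfolding \<alpha>[OF that] Z_formula_def G_def P_def by (simp add: mult_ac)
  have a_eq: "a n = \<alpha> (Suc n) * ((q ^ Suc n / q - 1) / (q ^ Suc n - 1))
      * ((q * q ^ Suc n - y) / (q * (q ^ Suc n - y)))" for n
    unfolding a_def br using q1 q(1) by simp
  have minus_1: "q ^ Suc n - 1 = (q - 1) * br (Suc n)" "q ^ Suc n / q - 1 = (q - 1) * br n" for n
    using q1 q(1) by (simp_all add: br)
  have lower: "(br (Suc n) - (q + 1) * br n) * \<alpha> (Suc n) + q * br (Suc n) * a n
      = br (Suc n) * (C * (q - 1) * G (Suc n) / (q * (q * (q ^ Suc n)^2 - y)))" for n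
  proof (cases "n = 0")
    \<comment> \<open>Since \<open>br 0 = 0\<close>, only \<open>\<alpha> 1\<close> survives; the
      quotient by \<open>q - y\<close> in \<open>a 0\<close> is multiplied by zero.\<close>
    case True
    then show ?thesis
      using \<alpha>1 by (simp add: br0 br1 a_def G_def mult_ac)
  next
    case False
    define K where "K = C * G (Suc n) / (q * (q ^ Suc n)^2 - y)"
    have "((q ^ Suc n - 1) - (q + 1) * (q ^ Suc n / q - 1)) * \<alpha> (Suc n) + q * (q ^ Suc n - 1) * a n
        = (q ^ Suc n - 1) * ((q - 1) * K / q)"
      unfolding K_def by (rule lower_coefficient[OF q(1) _ _ _ \<alpha>_G a_eq])
        (use False ne[of "Suc n"] sq_down[of "Suc n"] q(2)[rule_format, of "Suc n"] in auto)
    then have "(q - 1) * ((br (Suc n) - (q + 1) * br n) * \<alpha> (Suc n) + q * br (Suc n) * a n)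
        = (q - 1) * (br (Suc n) * ((q - 1) * K / q))"
      unfolding minus_1 by algebra
    then have "(br (Suc n) - (q + 1) * br n) * \<alpha> (Suc n) + q * br (Suc n) * a n
        = br (Suc n) * ((q - 1) * K / q)"
      using q1 mult_left_cancel by blast
    then show ?thesis
      by (simp add: K_def mult_ac)
  qed
  have upper: "br n * \<alpha> (Suc n) + (q * br n - (q + 1) * br (Suc n)) * a n
      = - (br n * (C * (q - 1) * G (Suc n) / (q * ((q ^ Suc n)^2 - q * y))))" if "n \<ge> 1" for n
  proof -
    define K where "K = C * G (Suc n) / ((q ^ Suc n)^2 - q * y)"
    have \<alpha>': "\<alpha> (Suc n) = (q ^ Suc n - 1) * (q ^ Suc n - y) / (q * (q ^ Suc n)^2 - y) * K"
      using \<alpha>_G[of "Suc n"] that by (simp add: K_def mult_ac)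
    have "(q ^ Suc n / q - 1) * \<alpha> (Suc n)
          + (q * (q ^ Suc n / q - 1) - (q + 1) * (q ^ Suc n - 1)) * a n
        = - ((q ^ Suc n / q - 1) * ((q - 1) * K / q))"
      by (rule upper_coefficient[OF q(1) _ _ _ \<alpha>' a_eq])
        (use that ne[of "Suc n"] sq_up[of "Suc n"] q(2)[rule_format, of "Suc n"] in auto)
    then have "(q - 1) * (br n * \<alpha> (Suc n) + (q * br n - (q + 1) * br (Suc n)) * a n)
        = (q - 1) * - (br n * ((q - 1) * K / q))"
      unfolding minus_1 by algebra
    then have "br n * \<alpha> (Suc n) + (q * br n - (q + 1) * br (Suc n)) * a n
        = - (br n * ((q - 1) * K / q))"
      using q1 mult_left_cancel by blast
    then show ?thesis
      by (simp add: K_def mult_ac)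
  qed
  \<comment> \<open>This is \<open>f\<close> without its scale: \<open>s\<close> enters the linear
    equations homogeneously and the quadratic one only through \<open>s^2 = C / y\<close>.\<close>
  define g where "g n = (k2 * q ^ n - y * k1) / ((q ^ n)^2 - y)" for n
  have f_g: "f n = s * g n" for n
    by (simp add: f_def g_def)
  have g_eq: "g n * ((q ^ n)^2 - y) = k2 * q ^ n - y * k1" if "n \<ge> 1" for n
    using sq[OF that] by (simp add: g_def)
  have f_eq: "f n * ((q ^ n)^2 - y) = (s * k2) * q ^ n - y * (s * k1)" if "n \<ge> 1" for n
    unfolding f_g mult.assoc g_eq[OF that] by (simp add: algebra_simps)

  \<comment> \<open>The five scalar equations\<close>
  show ?thesis
  proof (rule hahn_equation_jacobiI, unfold qb)
    show "a 0 = 0"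
      by (simp add: a_def br0)
    show "br (i + 2) - (q + 1) * br (i + 1) + q * br i = 0" for i
      by (simp add: br_Suc algebra_simps)
    \<comment> \<open>True for every \<open>f\<close>: the bracket recurrence kills the coefficients
      of \<open>f i\<close> and \<open>f (i + 2)\<close>, and those of \<open>f (i + 1)\<close>
      cancel.\<close>
    show "br (i + 1) * (\<beta> i + \<beta> (i + 1)) - (q + 1) * (br i * \<beta> i + br (i + 1) * b i)
        + q * br i * (b (i - 1) + b i) = 0" for i
      by (cases i) (simp_all add: \<beta>_def b_def br_Suc br0 algebra_simps)
    \<comment> \<open>The part from \<open>\<beta>\<close> and \<open>b\<close> factors as
      \<open>(\<beta> (j + 1) - b j) * (\<beta> (j + 1) - q * b j)\<close>. Its value is
      \<open>t\<close> plus two terms in \<open>G\<close>, which cancel against \<open>lower\<close>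
      at \<open>j\<close> and \<open>upper\<close> at \<open>j + 1\<close>.\<close>
    show "br (j + 1) * (\<alpha> (j + 1) + (\<beta> (j + 1))\<^sup>2 + \<alpha> (j + 2))
        - (q + 1) * (br j * \<alpha> (j + 1) + br (j + 1) * \<beta> (j + 1) * b j + br (j + 2) * a (j + 1))
        + q * br (j + 1) * (a j + (b j)\<^sup>2 + a (j + 1)) = ?t * br (j + 1)" for j
    proof -
      define x where "x = q ^ Suc j"
      have x: "q ^ Suc (Suc j) = q * x" "q ^ j = x / q"
        using q(1) by (simp_all add: x_def)
      define F H where "F = g (Suc j)" and "H = g (Suc (Suc j))"
      have d1: "\<beta> (Suc j) - b j = s * (x / q * (q * H - F))"
      proof -
        have "\<beta> (Suc j) - b j
            = s * ((br (Suc (Suc j)) - br (Suc j)) * H - (br (Suc j) - br j) * F)"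
          by (simp add: \<beta>_def b_def f_g F_def H_def algebra_simps)
        then show ?thesis
          unfolding br_power x(2) x_def[symmetric] using q(1) by (simp add: field_simps)
      qed
      have d2: "\<beta> (Suc j) - q * b j = s * (H - F)"
        by (simp add: \<beta>_def b_def f_g F_def H_def br_Suc algebra_simps)
      have R1: "x / y * (q * H - F) * (H - F) = - ((q - 1)^2 * (d1 * d2 * d3)) / q
          + (q - 1) / (q * x^2 - y) * (G (Suc (Suc j)) / q - G (Suc j))"
        using quadratic_relation[of x y q F d1 d2 d3 H] sq[of "Suc j"] sq[of "Suc (Suc j)"]
          sq_up[of "Suc j"] g_eq[of "Suc j"] g_eq[of "Suc (Suc j)"] y(1) q(1)
        unfolding G_def P_def x F_def H_def k1_def k2_def by (simp add: x_def)
      have R2: "(\<beta> (Suc j) - b j) * (\<beta> (Suc j) - q * b j)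
          = C / q * (x / y * (q * H - F) * (H - F))"
      proof -
        have "(\<beta> (Suc j) - b j) * (\<beta> (Suc j) - q * b j) = s^2 * (x / q * (q * H - F) * (H - F))"
          unfolding d1 d2 by (simp add: power2_eq_square)
        then show ?thesis
          unfolding s by (simp add: mult_ac)
      qed
      have expand: "C / q * (- (c * e) / q + r / U * (G2 / q - G1))
          = - (C * c * e) / q^2 + C * r * G2 / (q * (q * U)) - C * r * G1 / (q * U)"
        for c e r U G1 G2 :: complex
        by (simp add: distrib_left right_diff_distrib power2_eq_square mult_ac)
      have quad: "(\<beta> (Suc j) - b j) * (\<beta> (Suc j) - q * b j) = ?t
          + C * (q - 1) * G (Suc (Suc j)) / (q * (q * (q * x^2 - y)))
          - C * (q - 1) * G (Suc j) / (q * (q * x^2 - y))"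
        unfolding R2 R1 by (rule expand)
      have "br (Suc j) * (\<alpha> (Suc j) + (\<beta> (Suc j))\<^sup>2 + \<alpha> (Suc (Suc j)))
          - (q + 1) * (br j * \<alpha> (Suc j) + br (Suc j) * \<beta> (Suc j) * b j
            + br (Suc (Suc j)) * a (Suc j))
          + q * br (Suc j) * (a j + (b j)\<^sup>2 + a (Suc j))
        = br (Suc j) * ((\<beta> (Suc j) - b j) * (\<beta> (Suc j) - q * b j))
          + ((br (Suc j) - (q + 1) * br j) * \<alpha> (Suc j) + q * br (Suc j) * a j)
          + (br (Suc j) * \<alpha> (Suc (Suc j))
            + (q * br (Suc j) - (q + 1) * br (Suc (Suc j))) * a (Suc j))"
        by (simp add: power2_eq_square algebra_simps)
      also have "\<dots> = br (Suc j) * ((\<beta> (Suc j) - b j) * (\<beta> (Suc j) - q * b j))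
          + br (Suc j) * (C * (q - 1) * G (Suc j) / (q * (q * x^2 - y)))
          - br (Suc j) * (C * (q - 1) * G (Suc (Suc j)) / (q * (q * (q * x^2 - y))))"
      proof -
        have "(q ^ Suc (Suc j))^2 - q * y = q * (q * x^2 - y)"
          unfolding x by (simp add: power2_eq_square algebra_simps)
        then show ?thesis
          unfolding lower[of j] x_def[symmetric] using upper[of "Suc j"] by simp
      qed
      also have "\<dots> = ?t * br (Suc j)"
        unfolding quad by (simp add: algebra_simps)
      finally show ?thesis
        by simp
    qed
    \<comment> \<open>Once \<open>\<alpha> (j + 2) * br (j + 1)\<close> is factored out,
      \<open>linear_relation\<close> divided by \<open>q - 1\<close> remains.\<close>
    show "br (j + 1) * \<alpha> (j + 2) * (\<beta> (j + 1) + \<beta> (j + 2))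
        - (q + 1) * (br (j + 1) * \<alpha> (j + 2) * b j + br (j + 2) * \<beta> (j + 2) * a (j + 1))
        + q * br (j + 2) * a (j + 1) * (b j + b (j + 1)) = 0" for j
    proof -
      define x where "x = q ^ (j + 2)"
      have x: "q ^ j = x / q^2" "q ^ (j + 1) = x / q" "q ^ (j + 3) = q * x"
        using q(1) by (simp_all add: x_def power_add power2_eq_square power3_eq_cube)
      define v where "v = (q * x - y) / (q * (x - y))"
      define E F H where "E = f (j + 1)" and "F = f (j + 2)" and "H = f (j + 3)"
      have a: "br (j + 2) * a (j + 1) = \<alpha> (j + 2) * br (j + 1) * v"
        using br_nz[of "Suc j"] by (simp add: a_def v_def x_def numeral_3_eq_3)
      have "br (j + 1) * \<alpha> (j + 2) * (\<beta> (j + 1) + \<beta> (j + 2))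
          - (q + 1) * (br (j + 1) * \<alpha> (j + 2) * b j + br (j + 2) * \<beta> (j + 2) * a (j + 1))
          + q * br (j + 2) * a (j + 1) * (b j + b (j + 1))
        = br (j + 1) * \<alpha> (j + 2) * (\<beta> (j + 1) + \<beta> (j + 2) - (q + 1) * b j)
          + (br (j + 2) * a (j + 1)) * (q * (b j + b (j + 1)) - (q + 1) * \<beta> (j + 2))"
        by (simp add: algebra_simps)
      also have "\<dots> = \<alpha> (j + 2) * br (j + 1) * (br (j + 3) * H - br (j + 1) * E
          - (q + 1) * (br (j + 1) * F - br j * E)
          + v * (q * (br (j + 2) * H - br j * E) - (q + 1) * (br (j + 3) * H - br (j + 2) * F)))"
        unfolding a by (simp add: \<beta>_def b_def E_def F_def H_def numeral_3_eq_3 algebra_simps)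
      also have "br (j + 3) * H - br (j + 1) * E
          - (q + 1) * (br (j + 1) * F - br j * E)
          + v * (q * (br (j + 2) * H - br j * E) - (q + 1) * (br (j + 3) * H - br (j + 2) * F))
        = ((q * x - 1) * H - (x - q) / q * E - (q + 1) * ((x - q) / q * F - (x - q^2) / q^2 * E)
          + v * (q * ((x - 1) * H - (x - q^2) / q^2 * E)
              - (q + 1) * ((q * x - 1) * H - (x - 1) * F))) / (q - 1)"
      proof -
        have "br (j + 3) = (q * x - 1) / (q - 1)" "br (j + 2) = (x - 1) / (q - 1)"
          "br (j + 1) = (x - q) / q / (q - 1)" "br j = (x - q^2) / q^2 / (q - 1)"
          unfolding br x x_def[symmetric] using q(1) by (simp_all add: diff_divide_distrib)
        then show ?thesis
          by (simp only: add_divide_distrib diff_divide_distrib times_divide_eq_left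
              times_divide_eq_right right_diff_distrib left_diff_distrib distrib_left distrib_right)
      qed
      also have "\<dots> = 0"
      proof -
        have F: "F * (x^2 - y) = (s * k2) * x - y * (s * k1)"
          and H: "H * ((q * x)^2 - y) = (s * k2) * (q * x) - y * (s * k1)"
          and E: "E * ((x / q)^2 - y) = (s * k2) * (x / q) - y * (s * k1)"
          using f_eq[of "j + 2"] f_eq[of "j + 3"] f_eq[of "j + 1"]
          unfolding x x_def[symmetric] E_def F_def H_def by simp_all
        have "q^2 * (E * ((x / q)^2 - y)) = q^2 * ((s * k2) * (x / q) - y * (s * k1))"
          unfolding E ..
        then have "E * (x^2 - q^2 * y) = q * ((s * k2) * x - q * y * (s * k1))"
          using q(1) by (simp add: field_simps power2_eq_square)
        from linear_relation[OF q(1) _ this F H] show ?thesis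
          using ne[of "j + 2"] by (simp add: x_def v_def)
      qed
      finally show ?thesis
        by simp
    qed
    \<comment> \<open>Factoring out \<open>br (j + 1) * \<alpha> (j + 2) * \<alpha> (j + 3)\<close>
      leaves an identity in \<open>v\<close> and \<open>v'\<close>; in \<open>v * v'\<close> the
      factor \<open>q * x - y\<close> cancels.\<close>
    show "br (j + 1) * \<alpha> (j + 2) * \<alpha> (j + 3) - (q + 1) * br (j + 2) * \<alpha> (j + 3) * a (j + 1)
        + q * br (j + 3) * a (j + 1) * a (j + 2) = 0" for j
    proof -
      define x where "x = q ^ (j + 2)"
      have x: "q ^ (j + 3) = q * x" "q ^ (j + 4) = q^2 * x"
        by (simp_all add: x_def power_add power2_eq_square power3_eq_cube power4_eq_xxxx)
      define v v' where "v = (q * x - y) / (q * (x - y))"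
        and "v' = (q^2 * x - y) / (q * (q * x - y))"
      have a1: "br (j + 2) * a (j + 1) = \<alpha> (j + 2) * br (j + 1) * v"
        using br_nz[of "Suc j"] by (simp add: a_def v_def x_def numeral_3_eq_3)
      have a2: "br (j + 3) * a (j + 2) = \<alpha> (j + 3) * br (j + 2) * v'"
        using br_nz[of "Suc (Suc j)"]
        by (simp add: a_def v'_def x_def numeral_3_eq_3 power2_eq_square mult.assoc)
      have "br (j + 1) * \<alpha> (j + 2) * \<alpha> (j + 3) - (q + 1) * br (j + 2) * \<alpha> (j + 3) * a (j + 1)
          + q * br (j + 3) * a (j + 1) * a (j + 2)
        = br (j + 1) * \<alpha> (j + 2) * \<alpha> (j + 3)
          - (q + 1) * \<alpha> (j + 3) * (br (j + 2) * a (j + 1))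
          + q * a (j + 1) * (br (j + 3) * a (j + 2))"
        by (simp add: algebra_simps)
      also have "\<dots> = br (j + 1) * \<alpha> (j + 2) * \<alpha> (j + 3)
          - (q + 1) * \<alpha> (j + 3) * (br (j + 2) * a (j + 1))
          + q * \<alpha> (j + 3) * v' * (br (j + 2) * a (j + 1))"
        unfolding a2 by (simp add: algebra_simps)
      also have "\<dots> = br (j + 1) * \<alpha> (j + 2) * \<alpha> (j + 3) * (1 - (q + 1) * v + q * (v * v'))"
        unfolding a1 by (simp add: algebra_simps)
      also have "1 - (q + 1) * v + q * (v * v') = 0"
      proof -
        have "q * x - y \<noteq> 0" "x - y \<noteq> 0"
          using ne[of "j + 3"] ne[of "j + 2"] x by (simp_all add: x_def)
        then have "v * v' = (q^2 * x - y) / (q^2 * (x - y))"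
          using q(1) by (simp add: v_def v'_def power2_eq_square)
        then show ?thesis
          unfolding v_def using q(1) \<open>x - y \<noteq> 0\<close> by (simp add: field_simps power2_eq_square)
      qed
      finally show ?thesis
        by simp
    qed
  qed
qed

section \<open>The extended Hahn class\<close>

text \<open>Replacing \<open>y\<close> by \<open>x^2\<close> turns the left side into the expanded
  cubic with roots \<open>d1\<close>, \<open>d2\<close>, \<open>d3\<close>.\<close>

lemma monic_cubic_factor:
  fixes x y d1 d2 d3 :: "'a::comm_ring_1"
  assumes "x^2 = y"
  shows "x * (y + d1 * d2 + d1 * d3 + d2 * d3) - (y * (d1 + d2 + d3) + d1 * d2 * d3)
    = (x - d1) * (x - d2) * (x - d3)"
  unfolding assms[symmetric] by (simp add: power2_eq_square algebra_simps)

theorem theorem4p2: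
  fixes q p d1 d2 d3 y k1 k2 \<alpha>1 \<sigma>0 \<sigma>h0 :: complex
    and Z V Va :: "nat \<Rightarrow> complex"
    and \<alpha> \<sigma> \<sigma>h :: "nat \<Rightarrow> complex"
    and Lh Ah :: infmat
  assumes q_nonzero: "q \<noteq> 0"
    and q_not_root: "\<forall>n\<ge>1. q ^ n \<noteq> 1"
    and y_eq: "y = p^2"
    and k1_eq: "k1 = k1_of y d1 d2 d3"
    and k2_eq: "k2 = k2_of y d1 d2 d3"
    and Z_eq: "Z = Zval q y d1 d2 d3"
    and V_eq: "V = Vval q y d1 d2 d3"
    and Va_eq: "Va = Vaval q y d1 d2 d3"
    and V_nonzero: "V 0 \<noteq> 0"
    and Z_nonzero: "\<forall>k\<ge>1. Z k \<noteq> 0"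
    and p_nonzero: "p \<noteq> 0"
    and Va_num_nonzero: "k2 * q - y * k1 \<noteq> 0"
    and \<alpha>1_nonzero: "\<alpha>1 \<noteq> 0"
    and \<sigma>0_sq: "\<sigma>0^2 = \<alpha>1 * (V 0)^2 / Z 1"
    and \<sigma>h0_sq: "\<sigma>h0^2 = \<alpha>1 * (Va 0)^2 / (y * Z 1)"
    and root_choice: "\<sigma>h0^2 = \<sigma>0^2 \<longrightarrow> \<sigma>h0 = \<sigma>0"
    and \<alpha>_eq: "\<forall>k\<ge>1. \<alpha> k = \<alpha>1 * Z k / Z 1"
    and \<sigma>_eq: "\<forall>k. \<sigma> k = \<sigma>0 * V k / V 0"
    and \<sigma>h_eq: "\<forall>k. \<sigma>h k = \<sigma>h0 * Va k / Va 0"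
    and Lh_eq: "Lh = recurrence_matrix \<alpha> \<sigma>h"
    and Ah_eq: "Ah = MOP_of_recurrence Lh"
  shows "Ah \<in> extended_q_Hahn q
    \<and> (\<exists>M\<in>TT. hahn_equation q Lh M (- (\<alpha>1 * (q - 1)^2 * d1 * d2 * d3) / (q^2 * Z 1)))
    \<and> ((\<forall>k. \<sigma>h k = \<sigma> k) \<longleftrightarrow> (\<exists>d\<in>{d1, d2, d3}. p = d \<or> p = - d))"
proof -

  \<comment> \<open>Powers of \<open>q\<close> and the absence of poles\<close>
  have q1: "q - 1 \<noteq> 0"
    using q_not_root[rule_format, of 1] by simp
  have q_inj: "m = n" if "q ^ m = q ^ n" for m n
  proof -
    have "k = 0" if "q ^ (m + k) = q ^ m" for m k
    proof (rule ccontr)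
      assume "k \<noteq> 0"
      moreover have "q ^ k = 1"
        using that q_nonzero by (simp add: power_add)
      ultimately show False
        using q_not_root by simp
    qed
    then show ?thesis
      using that by (metis le_cases le_Suc_ex add_0_right)
  qed
  have y0: "y \<noteq> 0"
    using p_nonzero y_eq by simp
  have y_not_power: "q ^ n \<noteq> y" if "n \<ge> 2" for n
  proof
    assume y: "q ^ n = y"
    \<comment> \<open>By injectivity of the powers no denominator vanishes, so
      \<open>Zval_eq\<close> applies and the factor \<open>x - y\<close> gives
      \<open>Z n = 0\<close>. For \<open>n = 1\<close> this breaks down, as then
      \<open>(q ^ n)^2 = q * y\<close>.\<close>
    have "(q ^ n)^2 \<noteq> q * y" "(q ^ n)^2 \<noteq> y" "q * (q ^ n)^2 \<noteq> y"
      using q_inj[of "n * 2" "Suc n"] q_inj[of "n * 2" n] q_inj[of "Suc (n * 2)" n] that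
      by (auto simp: y[symmetric] power_mult[symmetric] simp flip: power_Suc)
    then have "Z n = 0"
      unfolding Z_eq by (subst Zval_eq) (simp_all add: Z_formula_def y)
    then show False
      using Z_nonzero that by simp
  qed
  then have y_not_powers: "\<forall>n\<ge>2. q ^ n \<noteq> y"
    by blast
  note nonvanishing = nonvanishing_shifts[OF q_nonzero y_not_powers]
  note sq = nonvanishing(2) and sq_up = nonvanishing(3) and sq_down = nonvanishing(4)
  have br: "qbracket q (int n) = (q ^ n - 1) / (q - 1)" for n
    by (rule qbracket_nat)
  have br_nz: "qbracket q (int (Suc n)) \<noteq> 0" for n
    unfolding br using q1 q_not_root[rule_format, of "Suc n"] by simp

  \<comment> \<open>The recurrence coefficients in explicit form\<close>
  have V_k: "V k = qbracket q (int (Suc k)) * ((k1 * q ^ Suc k - k2) / ((q ^ Suc k)^2 - y))" for k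
    using sq[of "Suc k"] q1 unfolding V_eq br
    by (subst Vval_eq) (simp_all add: V_formula_def k1_eq k2_eq power_mult_distrib mult.assoc)
  have Va_k: "Va k = qbracket q (int (Suc k)) * ((k2 * q ^ Suc k - y * k1) / ((q ^ Suc k)^2 - y))" for k
    using sq[of "Suc k"] q1 unfolding Va_eq br
    by (subst Vaval_eq) (simp_all add: Va_formula_def k1_eq k2_eq power_mult_distrib mult.assoc)
  have Va0: "Va 0 \<noteq> 0"
    using Va_num_nonzero br_nz[of 0] sq[of 1] by (simp add: Va_k)
  have Z1: "Z 1 \<noteq> 0"
    using Z_nonzero by simp
  define C where "C = \<alpha>1 / Z 1"
  \<comment> \<open>\<open>\<sigma>h\<close> is \<open>s\<close> times \<open>Va\<close>, and the
    hypothesis on \<open>\<sigma>h0^2\<close> gives \<open>s^2 = C / y\<close>.\<close>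
  define s where "s = \<sigma>h0 / Va 0"
  have s2: "s^2 = C / y"
    using \<sigma>h0_sq Va0 by (simp add: s_def C_def power_divide)
  define f where "f n = s * ((k2 * q ^ n - y * k1) / ((q ^ n)^2 - y))" for n
  define \<beta> where "\<beta> i = qbracket q (int (i + 1)) * f (i + 1) - qbracket q (int i) * f i" for i
  have \<sigma>h_k: "\<sigma>h k = qbracket q (int (Suc k)) * f (Suc k)" for k
  proof -
    have "\<sigma>h k = s * Va k"
      using \<sigma>h_eq by (simp add: s_def)
    then show ?thesis
      unfolding Va_k f_def by (simp only: mult.left_commute)
  qed
  have Lh: "Lh = jacobi \<beta> \<alpha>"
  proof -
    have "(if i = 0 then \<sigma>h 0 else \<sigma>h i - \<sigma>h (i - 1)) = \<beta> i" for i
      by (cases i) (simp_all add: \<sigma>h_k \<beta>_def qbracket_def)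
    then show ?thesis
      by (simp add: Lh_eq recurrence_matrix_eq_jacobi)
  qed
  have \<alpha>_k: "\<alpha> k = C * Z k" if "k \<ge> 1" for k
    using \<alpha>_eq that by (simp add: C_def)
  have \<alpha>_nz: "\<alpha> k \<noteq> 0" if "k \<ge> 1" for k
    using \<alpha>_k[OF that] Z_nonzero that \<alpha>1_nonzero Z1 by (simp add: C_def)
  have \<alpha>_1: "\<alpha> 1 = C * ((q - 1) / (q * (q^2 - y)^2 * (q * q^2 - y))
      * (((q - d1) * (d1 * q - y)) * ((q - d2) * (d2 * q - y)) * ((q - d3) * (d3 * q - y))))"
    using \<alpha>_k[of 1] Zval_1[OF q_nonzero, of y d1 d2 d3] sq[of 1] sq_up[of 1] by (simp add: Z_eq)
  have \<alpha>_ge2: "\<alpha> n = C * Z_formula q y d1 d2 d3 (q ^ n)" if "n \<ge> 2" for n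
    using \<alpha>_k[of n] Zval_eq[OF sq_down[OF that] sq sq_up] that by (simp add: Z_eq)

  \<comment> \<open>The matrix \<open>M\<close> and the Hahn equation\<close>
  define b where "b i = qbracket q (int (i + 1)) * f (i + 2) - qbracket q (int i) * f (i + 1)" for i
  define a where "a i = \<alpha> (i + 1) * (qbracket q (int i) / qbracket q (int (i + 1)))
      * ((q ^ (i + 2) - y) / (q * (q ^ (i + 1) - y)))" for i
  have "a k \<noteq> 0" if k: "k \<ge> 1" for k
  proof -
    have "qbracket q (int k) \<noteq> 0" "qbracket q (int (k + 1)) \<noteq> 0"
      using br_nz[of "k - 1"] br_nz[of k] k by simp_all
    then show ?thesis
      using \<alpha>_nz[of "k + 1"] y_not_power[of "k + 1"] y_not_power[of "k + 2"] q_nonzero k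
      by (simp add: a_def)
  qed
  then have M: "jacobi b a \<in> TT"
    by (rule jacobi_in_TT)
  have "hahn_equation q (jacobi \<beta> \<alpha>) (jacobi b a) (- (C * (q - 1)^2 * (d1 * d2 * d3)) / q^2)"
    using hahn_equation_explicit[OF q_nonzero q_not_root y0 y_not_powers s2 \<alpha>_1 \<alpha>_ge2]
    unfolding \<beta>_def[abs_def] b_def[abs_def] a_def[abs_def] f_def k1_eq k2_eq by simp
  moreover have "- (C * (q - 1)^2 * (d1 * d2 * d3)) / q^2
      = - (\<alpha>1 * (q - 1)^2 * d1 * d2 * d3) / (q^2 * Z 1)"
    by (simp add: C_def mult_ac)
  ultimately have hahn: "hahn_equation q Lh (jacobi b a) (- (\<alpha>1 * (q - 1)^2 * d1 * d2 * d3) / (q^2 * Z 1))"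
    by (simp only: Lh)
  have "Ah \<in> extended_q_Hahn q"
    using is_MOP_of_recurrence[of \<alpha> \<beta>] \<alpha>_nz hahn M
    unfolding extended_q_Hahn_def Ah_eq Lh by blast

  \<comment> \<open>Coincidence of the two sequences\<close>
  moreover have "(\<forall>k. \<sigma>h k = \<sigma> k) \<longleftrightarrow> (\<exists>d\<in>{d1, d2, d3}. p = d \<or> p = - d)"
  proof
    assume eq: "\<forall>k. \<sigma>h k = \<sigma> k"
    define l where "l = Va 0 / V 0"
    have "\<sigma>h0 = \<sigma>0"
      using eq[rule_format, of 0] \<sigma>_eq \<sigma>h_eq Va0 V_nonzero by simp
    moreover have "\<sigma>0 \<noteq> 0"
      using \<sigma>0_sq V_nonzero \<alpha>1_nonzero Z1 by auto
    ultimately have Va_V: "Va k = l * V k" for k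
      using eq[rule_format, of k] \<sigma>_eq \<sigma>h_eq Va0 V_nonzero by (simp add: l_def field_simps)
    have l2: "l^2 = y"
    proof -
      have "\<alpha>1 * (Va 0)^2 / (y * Z 1) = \<alpha>1 * (V 0)^2 / Z 1"
        using \<open>\<sigma>h0 = \<sigma>0\<close> \<sigma>0_sq \<sigma>h0_sq by simp
      then show ?thesis
        using \<alpha>1_nonzero Z1 y0 V_nonzero by (simp add: l_def power_divide field_simps)
    qed
    have lin: "k2 * q ^ Suc k - y * k1 = l * (k1 * q ^ Suc k - k2)" for k
      using Va_V[of k] sq[of "Suc k"] br_nz[of k] by (simp add: V_k Va_k del: power_Suc of_nat_Suc)
    \<comment> \<open>\<open>lin\<close> equates two affine functions at the distinct points
      \<open>q\<close> and \<open>q^2\<close>, so their slopes \<open>k2\<close> and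
      \<open>l * k1\<close> agree.\<close>
    have "(k2 - l * k1) * (q * (q - 1)) = 0"
      using lin[of 0] lin[of 1] unfolding One_nat_def power_Suc power_0 by algebra
    then have "l * k1 - k2 = 0"
      using q1 q_nonzero by simp
    then have "(l - d1) * (l - d2) * (l - d3) = 0"
      using monic_cubic_factor[OF l2, of d1 d2 d3] by (simp add: k1_eq k2_eq k1_of_def k2_of_def)
    moreover have "p = l \<or> p = - l"
      using l2 y_eq power2_eq_iff by metis
    ultimately show "\<exists>d\<in>{d1, d2, d3}. p = d \<or> p = - d"
      by auto
  next
    assume "\<exists>d\<in>{d1, d2, d3}. p = d \<or> p = - d"
    then obtain d where d: "d \<in> {d1, d2, d3}" and "p = d \<or> p = - d"
      by blast
    then have d2: "d^2 = y"
      using y_eq by auto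
    have "(d - d1) * (d - d2) * (d - d3) = 0"
      using d by auto
    then have "d * k1 - k2 = 0"
      using monic_cubic_factor[OF d2, of d1 d2 d3] by (simp only: k1_eq k2_eq k1_of_def k2_of_def)
    then have k2: "k2 = d * k1"
      by simp
    have Va_V: "Va k = d * V k" for k
      unfolding Va_k V_k k2 by (simp add: d2[symmetric] power2_eq_square algebra_simps)
    have "d \<noteq> 0"
      using d2 y0 by auto
    \<comment> \<open>\<open>d^2 = y\<close> cancels the \<open>y\<close> in the denominator of
      \<open>\<sigma>h0^2\<close>; \<open>root_choice\<close> then rules out the opposite
      sign.\<close>
    then have "\<sigma>h0^2 = \<sigma>0^2"
      unfolding \<sigma>0_sq \<sigma>h0_sq Va_V by (simp add: d2[symmetric] power_mult_distrib)
    then have "\<sigma>h0 = \<sigma>0"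
      using root_choice by simp
    then show "\<forall>k. \<sigma>h k = \<sigma> k"
      using \<sigma>_eq \<sigma>h_eq \<open>d \<noteq> 0\<close> by (simp add: Va_V)
  qed
  ultimately show ?thesis
    using hahn M by blast
qed

end
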